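(* Let $\mathbb{F}\in\{\mathbb{R},\mathbb{C}\}$, let $H\in\mathbb{F}^{n,n}$ be nonsingular with $H^*=H$, let $X\in\mathbb{F}^{n,n}$, and let $X=UA$ be an $H$-polar decomposition with commuting factors. If $X=\widetilde{U}A$ is another $H$-polar decomposition of $X$ (with the same $H$-selfadjoint factor $A$), then $\widetilde{U}A=A\widetilde{U}$.
   Context: $\mathbb{F}^{n,n}$ denotes the $n\times n$ matrices over $\mathbb{F}$ and $M^*=\overline{M}^T$ the conjugate transpose (the transpose if $\mathbb{F}=\mathbb{R}$). For nonsingular $H=H^*$, the $H$-adjoint of $M\in\mathbb{F}^{n,n}$ is $M^{[*]}=H^{-1}M^*H$. A matrix $M$ is $H$-selfadjoint if $M^{[*]}=M$ and $H$-unitary if $M^{[*]}M=I_n$. An $H$-polar decomposition of $X\in\mathbb{F}^{n,n}$ is a factorisation $X=UA$ with $U,A\in\mathbb{F}^{n,n}$, $U$ $H$-unitary and $A$ $H$-selfadjoint (no definiteness or spectral condition is imposed on $A$). It has commuting factors if $UA=AU$. *)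

theory Defs
  imports "HOL-Analysis.Analysis" "Jordan_Normal_Form.Conjugate"
begin

text \<open>
  The definitions are polymorphic in the field. They are intended for
  \<^typ>\<open>real\<close>, where \<^const>\<open>conjugate\<close> is the identity, and \<^typ>\<open>complex\<close>,
  where it is \<^const>\<open>cnj\<close>.
\<close>

definition conj_transpose :: "'a::conjugate ^ 'n ^ 'm \<Rightarrow> 'a ^ 'm ^ 'n" where
  "conj_transpose M = (\<chi> i j. conjugate (M $ j $ i))"

text \<open>
  \<^const>\<open>matrix_inv\<close> is the inverse only for invertible matrices, so the notions
  below carry their usual meaning only for nonsingular \<open>H\<close>. That \<open>H\<close> is nonsingular
  and satisfies \<open>conj_transpose H = H\<close> is not part of the definitions and has to be
  assumed where they are used.
\<close>

definition H_adjoint :: "'a::conjugatable_field ^ 'n ^ 'n \<Rightarrow> 'a ^ 'n ^ 'n \<Rightarrow> 'a ^ 'n ^ 'n" where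
  "H_adjoint H M = matrix_inv H ** conj_transpose M ** H"

definition H_selfadjoint :: "'a::conjugatable_field ^ 'n ^ 'n \<Rightarrow> 'a ^ 'n ^ 'n \<Rightarrow> bool" where
  "H_selfadjoint H M \<longleftrightarrow> H_adjoint H M = M"

definition H_unitary :: "'a::conjugatable_field ^ 'n ^ 'n \<Rightarrow> 'a ^ 'n ^ 'n \<Rightarrow> bool" where
  "H_unitary H M \<longleftrightarrow> H_adjoint H M ** M = mat 1"

definition H_polar_decomposition ::
  "'a::conjugatable_field ^ 'n ^ 'n \<Rightarrow> 'a ^ 'n ^ 'n \<Rightarrow> 'a ^ 'n ^ 'n \<Rightarrow> 'a ^ 'n ^ 'n \<Rightarrow> bool" where
  "H_polar_decomposition H X U A \<longleftrightarrow> X = U ** A \<and> H_unitary H U \<and> H_selfadjoint H A"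

end

theory Submission
  imports Defs
begin

text \<open>
  Two \<open>H\<close>-unitary factors \<open>U\<close>, \<open>U'\<close> of the same matrix agree on the range of \<open>A\<close>.
  Write \<open>V\<close> and \<open>V'\<close> for the adjoints of \<open>U\<close> and \<open>U'\<close>, which are also their inverses.
  Since \<open>A\<close> is its own adjoint and the adjoint reverses products (\<open>H_adjoint_mult\<close>),
  adjoining \<open>U A = U' A\<close> yields \<open>A V = A V'\<close>, hence \<open>A V U' = A\<close>: the same agreement,
  seen from the other side of \<open>A\<close>. Multiplying by \<open>U\<close> on the left and moving \<open>U\<close> past
  \<open>A\<close> turns this into \<open>A U' = U A = U' A\<close>. Nowhere is \<open>A\<close> cancelled, so a singular
  \<open>A\<close> is covered, and the argument is uniform in the field.
\<close>

lemma conj_transpose_mult: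
  fixes M :: "'a::conjugatable_field ^ 'n ^ 'm" and N :: "'a ^ 'k ^ 'n"
  shows "conj_transpose (M ** N) = conj_transpose N ** conj_transpose M"
  by (simp add: vec_eq_iff conj_transpose_def matrix_matrix_mult_def sum_conjugate
      conjugate_dist_mul mult.commute)

lemma H_adjoint_mult:
  fixes H :: "'a::conjugatable_field ^ 'n ^ 'n"
  assumes "invertible H"
  shows "H_adjoint H (M ** N) = H_adjoint H N ** H_adjoint H M"
proof -
  have "H ** matrix_inv H = mat 1"
    using assms unfolding invertible_def matrix_inv_def by (rule someI2_ex) simp
  have "H_adjoint H N ** H_adjoint H M
      = matrix_inv H ** conj_transpose N ** (H ** matrix_inv H) ** conj_transpose M ** H"
    by (simp add: H_adjoint_def matrix_mul_assoc)
  also have "\<dots> = H_adjoint H (M ** N)"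
    by (simp add: \<open>H ** matrix_inv H = mat 1\<close> H_adjoint_def conj_transpose_mult matrix_mul_assoc)
  finally show ?thesis by simp
qed

lemma H_polar_decomposition_same_selfadjoint_factor_commutes:
  fixes H :: "'a::conjugatable_field ^ 'n ^ 'n"
  assumes H: "invertible H"
    and XU: "H_polar_decomposition H X U A"
    and comm: "U ** A = A ** U"
    and XU': "H_polar_decomposition H X U' A"
  shows "U' ** A = A ** U'"
proof -
  let ?adj = "H_adjoint H"
  have same: "U ** A = U' ** A" and A: "?adj A = A"
    and U: "?adj U ** U = mat 1" and U': "?adj U' ** U' = mat 1"
    using XU XU'
    by (auto simp: H_polar_decomposition_def H_unitary_def H_selfadjoint_def)
  have "A ** ?adj U = A ** ?adj U'"
    using arg_cong[OF same, of ?adj] by (simp add: H_adjoint_mult[OF H] A)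
  then have "A ** ?adj U ** U' = A"
    by (metis U' matrix_mul_assoc matrix_mul_rid)
  then have "U ** A = A ** (U ** ?adj U) ** U'"
    by (metis comm matrix_mul_assoc)
  also have "\<dots> = A ** U'"
    using U by (simp add: matrix_left_right_inverse)
  finally show ?thesis using same by simp
qed

theorem proposition3p13:
  shows "(\<forall>(H :: real ^ 'n ^ 'n) X U A U'.
            invertible H \<and> conj_transpose H = H \<and>
            H_polar_decomposition H X U A \<and> U ** A = A ** U \<and>
            H_polar_decomposition H X U' A
            \<longrightarrow> U' ** A = A ** U')
       \<and> (\<forall>(H :: complex ^ 'n ^ 'n) X U A U'.
            invertible H \<and> conj_transpose H = H \<and>
            H_polar_decomposition H X U A \<and> U ** A = A ** U \<and>
            H_polar_decomposition H X U' A
            \<longrightarrow> U' ** A = A ** U')"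
  by (intro conjI allI impI; elim conjE; rule H_polar_decomposition_same_selfadjoint_factor_commutes)

end
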